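(* The following hold: (i) The set of all quadratic algebraic integers in $\mathbb{C}\setminus\mathbb{R}$ is equal to the disjoint union $$\biguplus_{n \in \mathbb{Z},\ \varepsilon \in \{-1,+1\}} \left(\varepsilon \hat{S}^{2,i} + n\right).$$ The set of all quadratic algebraic integers in $\mathbb{C}\setminus\mathbb{R}$ except those in $\mathbb{Q}(\sqrt{-1})$ is equal to the disjoint union $$\biguplus_{n \in \mathbb{Z},\ \varepsilon \in \{-1,+1\}} \left(\varepsilon S^{2,i} + n\right).$$ (In both cases disjointness means that the sets for distinct pairs $(n,\varepsilon)$ are pairwise disjoint.) (ii) In particular, $\hat{S}^{2,i}$ includes a primitive element (over $\mathbb{Q}$) of any imaginary quadratic field; $S^{2,i}$ includes a primitive element of any imaginary quadratic field except $\mathbb{Q}(\sqrt{-1})$.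
   Context: A quadratic algebraic integer is an algebraic integer of degree exactly two over $\mathbb{Q}$. An imaginary quadratic field is a subfield of $\mathbb{C}$ of degree two over $\mathbb{Q}$ not contained in $\mathbb{R}$. For a positive integer $c$, $\sqrt{-c}$ denotes $\sqrt{c}\,\sqrt{-1}$ (the root with positive imaginary part), and likewise $\sqrt{1-4c} = \sqrt{4c-1}\,\sqrt{-1}$. For an integer $n \ge 1$ define $$I_n^{2,i} := \left\{\tfrac{1+\sqrt{1-4c}}{2} \in \mathbb{C}\setminus\mathbb{R} \;\middle|\; c \in \mathbb{Z},\ \left(\tfrac{n-1}{2}\right)^2+1 \le c \le \left(\tfrac{n+1}{2}\right)^2\right\} \quad \text{if } n \text{ is odd},$$ $$I_n^{2,i} := \left\{\sqrt{-c} \in \mathbb{C}\setminus\mathbb{R} \;\middle|\; c \in \mathbb{Z},\ \left(\tfrac{n}{2}\right)^2 < c < \left(\tfrac{n}{2}+1\right)^2\right\} \quad \text{if } n \text{ is even}.$$ Put $$S^{2,i} := \bigcup_{n \ge 1} I_n^{2,i}, \qquad \hat{S}^{2,i} := S^{2,i} \cup \{n\sqrt{-1} \mid n \in \mathbb{Z}_{>0}\}.$$ For a set $S \subset \mathbb{C}$ and an integer $n$: $+S := S$, $-S := \{-\alpha \mid \alpha \in S\}$ and $S+n := \{\alpha+n \mid \alpha \in S\}$; $\varepsilon S$ means $+S$ for $\varepsilon=+1$ and $-S$ for $\varepsilon=-1$. *)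

theory Defs
  imports
    Complex_Main
    "HOL-Library.Disjoint_Sets"
    "HOL-Algebra.Generated_Fields"
    "HOL-Algebra.Algebraic_Closure_Type"
begin

abbreviation complex_ring :: "complex ring" where
  "complex_ring \<equiv> ring_of_type_algebra"

definition degree_over_Q :: "complex \<Rightarrow> nat" where
  "degree_over_Q \<alpha> = Polynomials.degree (ring.Irr complex_ring \<rat> \<alpha>)"

definition quadratic_algebraic_int :: "complex \<Rightarrow> bool" where
  "quadratic_algebraic_int \<alpha> \<longleftrightarrow> algebraic_int \<alpha> \<and> degree_over_Q \<alpha> = 2"

definition Q_adjoin :: "complex \<Rightarrow> complex set" where
  "Q_adjoin \<alpha> = generate_field complex_ring (insert \<alpha> \<rat>)"

definition imaginary_quadratic_field :: "complex set \<Rightarrow> bool" where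
  "imaginary_quadratic_field K \<longleftrightarrow>
     subfield K complex_ring \<and> ring.dimension complex_ring 2 \<rat> K \<and> \<not> K \<subseteq> \<real>"

definition primitive_element :: "complex set \<Rightarrow> complex \<Rightarrow> bool" where
  "primitive_element K \<alpha> \<longleftrightarrow> Q_adjoin \<alpha> = K"

text \<open>
  The principal root \<^const>\<open>csqrt\<close> of a negative real number is the one with positive imaginary part.
\<close>

lemma csqrt_minus_of_int:
  fixes c :: int
  assumes "c > 0"
  shows "csqrt (- of_int c) = of_real (sqrt (of_int c)) * \<i>"
  using assms by (subst csqrt_of_real_nonpos) auto

lemma csqrt_one_minus_four_of_int:
  fixes c :: int
  assumes "c > 0"
  shows "csqrt (1 - 4 * of_int c) = of_real (sqrt (4 * of_int c - 1)) * \<i>"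
  using assms by (subst csqrt_of_real_nonpos) auto

definition I2i :: "int \<Rightarrow> complex set" where
  "I2i n =
     (if odd n then
        {\<alpha>. \<alpha> \<notin> \<real> \<and> (\<exists>c::int. \<alpha> = (1 + csqrt (1 - 4 * of_int c)) / 2 \<and>
            ((real_of_int n - 1) / 2)\<^sup>2 + 1 \<le> real_of_int c \<and>
            real_of_int c \<le> ((real_of_int n + 1) / 2)\<^sup>2)}
      else
        {\<alpha>. \<alpha> \<notin> \<real> \<and> (\<exists>c::int. \<alpha> = csqrt (- of_int c) \<and>
            (real_of_int n / 2)\<^sup>2 < real_of_int c \<and>
            real_of_int c < (real_of_int n / 2 + 1)\<^sup>2)})"

definition S2i :: "complex set" where
  "S2i = (\<Union>n\<in>{1..}. I2i n)"

definition S2i_hat :: "complex set" where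
  "S2i_hat = S2i \<union> {of_int n * \<i> | n::int. n > 0}"

definition signed_set :: "int \<Rightarrow> complex set \<Rightarrow> complex set" where
  "signed_set \<epsilon> S = (if \<epsilon> = -1 then uminus ` S else S)"

definition translate_set :: "complex set \<Rightarrow> int \<Rightarrow> complex set" where
  "translate_set S n = (\<lambda>\<alpha>. \<alpha> + of_int n) ` S"

end

theory Submission
  imports Defs
begin

text \<open>
  A non-real \<open>\<alpha>\<close> is a root of a unique monic real quadratic, \<open>X\<^sup>2 - 2 (Re \<alpha>) X + \<bar>\<alpha>\<bar>\<^sup>2\<close>. Hence it is a
  quadratic algebraic integer iff \<open>2 (Re \<alpha>)\<close> and \<open>\<bar>\<alpha>\<bar>\<^sup>2\<close> are integers, where the forward direction is
  Gauss's lemma. These two conditions are invariant under integer translations and sign changes.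
  The sign makes \<open>Im \<alpha> > 0\<close>, after which a unique translation makes \<open>Re \<alpha> \<in> {0, 1/2}\<close>; the numbers
  satisfying all these conditions form \<open>S2i_hat\<close>, because the intervals for \<open>c\<close> in
  \<open>I2i n\<close> with \<open>n\<close> odd cover all positive integers, and those with \<open>n\<close> even all positive non-squares.
  Among them, exactly the positive integer multiples of \<open>\<i>\<close> lie in \<open>\<rat>(\<i>)\<close>, as \<open>4c - 1\<close> is never a square.
  An imaginary quadratic field is generated by any of its non-real elements, and normalising an
  integral one yields a generator in \<open>S2i_hat\<close>.
\<close>

section \<open>Subfields of the complex numbers\<close>

lemma complex_ring_simps [simp]:
  "carrier complex_ring = UNIV" "x \<otimes>\<^bsub>complex_ring\<^esub> y = x * y"
  "x \<oplus>\<^bsub>complex_ring\<^esub> y = x + y" "\<one>\<^bsub>complex_ring\<^esub> = 1" "\<zero>\<^bsub>complex_ring\<^esub> = 0"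
  by (simp_all add: ring_of_type_algebra_def)

context
begin

interpretation C: field complex_ring
  by (rule field_from_type_algebra)

lemma complex_ring_a_inv [simp]: "\<ominus>\<^bsub>complex_ring\<^esub> x = - x"
  using C.minus_equality[of "- x" x] by simp

lemma complex_ring_m_inv [simp]: "x \<noteq> 0 \<Longrightarrow> inv\<^bsub>complex_ring\<^esub> x = inverse x"
  using C.comm_inv_char[of x "inverse x"] by simp

lemma subfield_complexI:
  assumes "1 \<in> K" "\<And>x. x \<in> K \<Longrightarrow> - x \<in> K" "\<And>x. x \<in> K \<Longrightarrow> x \<noteq> 0 \<Longrightarrow> inverse x \<in> K"
    "\<And>x y. x \<in> K \<Longrightarrow> y \<in> K \<Longrightarrow> x * y \<in> K" "\<And>x y. x \<in> K \<Longrightarrow> y \<in> K \<Longrightarrow> x + y \<in> K"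
  shows "subfield K complex_ring"
  by (intro C.subfieldI' C.subringI) (use assms in auto)

lemma
  assumes "subfield K complex_ring"
  shows subfield_complex_1: "1 \<in> K"
    and subfield_complex_uminus: "x \<in> K \<Longrightarrow> - x \<in> K"
    and subfield_complex_inverse: "x \<in> K \<Longrightarrow> inverse x \<in> K"
    and subfield_complex_mult: "x \<in> K \<Longrightarrow> y \<in> K \<Longrightarrow> x * y \<in> K"
    and subfield_complex_add: "x \<in> K \<Longrightarrow> y \<in> K \<Longrightarrow> x + y \<in> K"
proof -
  note K = subfieldE(1)[OF assms]
  show "1 \<in> K" "x \<in> K \<Longrightarrow> - x \<in> K" "x \<in> K \<Longrightarrow> y \<in> K \<Longrightarrow> x * y \<in> K"
    "x \<in> K \<Longrightarrow> y \<in> K \<Longrightarrow> x + y \<in> K"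
    using subringE(3)[OF K] subringE(5)[OF K, of x] subringE(6)[OF K, of x y] subringE(7)[OF K, of x y]
    by auto
  show "inverse x \<in> K" if "x \<in> K"
    using that C.subfield_m_inv(1)[OF assms, of x] by (cases "x = 0") auto
qed

lemma subfield_complex_of_int:
  assumes "subfield K complex_ring"
  shows "of_int n \<in> K"
proof (induction n rule: int_of_nat_induct)
  case (nonneg n)
  have "0 \<in> K"
    using subringE(2)[OF subfieldE(1)[OF assms]] by simp
  then show ?case
    by (induction n) (auto intro: subfield_complex_add[OF assms] subfield_complex_1[OF assms])
next
  case (neg n)
  have "of_nat m \<in> K" for m
    using subringE(2)[OF subfieldE(1)[OF assms]]
    by (induction m) (auto intro: subfield_complex_add[OF assms] subfield_complex_1[OF assms])
  from subfield_complex_uminus[OF assms this[of "Suc n"]] show ?case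
    by simp
qed

lemma Rats_subset_subfield:
  assumes "subfield K complex_ring"
  shows "\<rat> \<subseteq> K"
  by (auto elim!: Rats_cases' simp: divide_inverse
      intro!: subfield_complex_mult[OF assms] subfield_complex_inverse[OF assms]
        subfield_complex_of_int[OF assms])

section \<open>Adjunction to the rationals and imaginary quadratic fields\<close>

lemma subfield_Rats: "subfield \<rat> complex_ring"
  by (rule subfield_complexI) auto

lemma subfield_Q_adjoin: "subfield (Q_adjoin \<alpha>) complex_ring"
  unfolding Q_adjoin_def by (rule C.generate_field_is_subfield) simp

lemma Q_adjoin_self: "\<alpha> \<in> Q_adjoin \<alpha>"
  unfolding Q_adjoin_def by (rule generate_field.incl) simp

lemma Q_adjoin_least:
  assumes "subfield K complex_ring" "\<alpha> \<in> K"
  shows "Q_adjoin \<alpha> \<subseteq> K"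
  unfolding Q_adjoin_def
  by (rule C.generate_field_min_subfield1) (use assms Rats_subset_subfield in auto)

text \<open>The numbers with rational real and imaginary parts form a subfield that contains \<i>,
  so they contain the least such field.\<close>

lemma Re_Im_Rats_if_mem_Q_adjoin_ii:
  assumes "z \<in> Q_adjoin \<i>"
  shows "Re z \<in> \<rat>" "Im z \<in> \<rat>"
proof -
  have "subfield {z. Re z \<in> \<rat> \<and> Im z \<in> \<rat>} complex_ring"
    by (rule subfield_complexI) (auto simp: Re_divide Im_divide)
  from Q_adjoin_least[OF this, of \<i>] assms show "Re z \<in> \<rat>" "Im z \<in> \<rat>"
    by auto
qed

text \<open>A non-real \<alpha> is not rational, so \<alpha> and 1 are independent over \<rat>, and
  two independent elements span a space of dimension 2.\<close>

lemma imaginary_quadratic_field_span: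
  assumes K: "imaginary_quadratic_field K" and \<alpha>: "\<alpha> \<in> K" "\<alpha> \<notin> \<real>" and z: "z \<in> K"
  obtains a b where "a \<in> \<rat>" "b \<in> \<rat>" "z = a + b * \<alpha>"
proof -
  have sub: "subfield K complex_ring" and dim: "ring.dimension complex_ring 2 \<rat> K"
    using K by (auto simp: imaginary_quadratic_field_def)
  have Span1: "C.Span \<rat> [1] = \<rat>"
    by (auto simp: C.line_extension_mem_iff)
  have "\<alpha> \<notin> \<rat>"
    using \<alpha>(2) by (metis Rats_cases' Reals_divide Reals_of_int)
  then have "C.independent \<rat> [\<alpha>, 1]"
    using Span1 by (intro C.li_Cons C.li_Nil) auto
  moreover have "set [\<alpha>, 1] \<subseteq> K"
    using \<alpha> subfield_complex_1[OF sub] by auto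
  ultimately have "C.Span \<rat> [\<alpha>, 1] = K"
    using C.independent_length_eq_dimension[OF subfield_Rats dim, of "[\<alpha>, 1]"] by simp
  moreover have "C.Span \<rat> [\<alpha>, 1] = C.line_extension \<rat> \<alpha> \<rat>"
    using Span1 by simp
  ultimately have "z \<in> C.line_extension \<rat> \<alpha> \<rat>"
    using z by simp
  then obtain b a where "b \<in> \<rat>" "a \<in> \<rat>" "z = b * \<alpha> + a"
    by (auto simp: C.line_extension_mem_iff)
  then show thesis
    by (intro that[of a b]) auto
qed

text \<open>A field containing \<alpha> contains all rational combinations of 1 and \<alpha>, and
  these exhaust \<open>K\<close>. Finding a primitive element thus reduces to finding a non-real
  element of \<open>K\<close> in the required set.\<close>

lemma imaginary_quadratic_field_eq_Q_adjoin:
  assumes K: "imaginary_quadratic_field K" and \<alpha>: "\<alpha> \<in> K" "\<alpha> \<notin> \<real>"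
  shows "Q_adjoin \<alpha> = K"
proof
  show "Q_adjoin \<alpha> \<subseteq> K"
    using Q_adjoin_least K \<alpha> by (auto simp: imaginary_quadratic_field_def)
  show "K \<subseteq> Q_adjoin \<alpha>"
  proof
    fix z assume "z \<in> K"
    then obtain a b where "a \<in> \<rat>" "b \<in> \<rat>" "z = a + b * \<alpha>"
      using imaginary_quadratic_field_span[OF K \<alpha>] by metis
    then show "z \<in> Q_adjoin \<alpha>"
      using Rats_subset_subfield[OF subfield_Q_adjoin]
      by (auto intro!: subfield_complex_add[OF subfield_Q_adjoin]
          subfield_complex_mult[OF subfield_Q_adjoin] Q_adjoin_self)
  qed
qed

section \<open>Algebraic integers and their minimal polynomials over the rationals\<close>

lemma algebraic_over_Rats_if_algebraic_int:
  assumes "algebraic_int (\<alpha> :: complex)"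
  shows "(C.algebraic over \<rat>) \<alpha>"
proof -
  obtain p :: "complex poly" where p: "lead_coeff p = 1" "\<forall>i. poly.coeff p i \<in> \<int>" "poly p \<alpha> = 0"
    using assms by (auto elim: algebraic_int.cases)
  have "p \<noteq> 0" using p by auto
  \<comment> \<open>HOL-Algebra polynomials are coefficient lists with the leading coefficient
    first, the reverse of \<open>coeffs\<close>. Evaluating the reversed list is Horner's
    scheme.\<close>
  have eval: "C.eval (rev cs) x = horner_sum (\<lambda>a. a) x cs" for cs x
  proof (induction cs)
    case (Cons c cs)
    have "C.eval (as @ [c]) x = C.eval as x * x + c" for as
      using C.eval_append_aux[of as c x] by simp
    with Cons show ?case by (simp add: algebra_simps)
  qed auto
  show ?thesis
  proof (rule C.algebraicI)
    show "rev (coeffs p) \<in> carrier (\<rat>[X]\<^bsub>complex_ring\<^esub>)"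
      using p \<open>p \<noteq> 0\<close> Ints_subset_Rats
      by (auto simp: univ_poly_def polynomial_def hd_rev last_coeffs_eq_coeff_degree coeffs_def)
    show "rev (coeffs p) \<noteq> []" using \<open>p \<noteq> 0\<close> by simp
    show "C.eval (rev (coeffs p)) \<alpha> = \<zero>\<^bsub>complex_ring\<^esub>"
      using p(3) unfolding eval
      by (simp add: horner_sum_foldr poly_def fold_coeffs_def)
  qed
qed

text \<open>The minimal polynomial divides every rational polynomial vanishing at \<alpha>, so a
  monic quadratic bounds its degree by 2, and degree 1 would make \<alpha> rational. Conversely a
  minimal polynomial of degree 2, being monic, is such a quadratic.\<close>

lemma degree_over_Q_eq_2_iff:
  assumes "algebraic_int \<alpha>" "\<alpha> \<notin> \<real>"
  shows "degree_over_Q \<alpha> = 2 \<longleftrightarrow> (\<exists>p\<in>\<rat>. \<exists>q\<in>\<rat>. \<alpha>\<^sup>2 + p * \<alpha> + q = 0)"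
proof -
  define f where "f = C.Irr \<rat> \<alpha>"
  note alg = algebraic_over_Rats_if_algebraic_int[OF assms(1)]
  note Irr = C.IrrE[OF subfield_Rats _ alg, folded f_def, simplified]
  have fQ: "set f \<subseteq> \<rat>" "f \<noteq> []"
    using Irr(1,2) by (auto simp: univ_poly_def polynomial_def ring_irreducible_def)
  \<comment> \<open>Since \<open>f\<close> is monic, the length of \<open>fs\<close> is its
    degree.\<close>
  then obtain fs where f: "f = 1 # fs"
    using Irr(3) by (cases f) auto
  show ?thesis
  proof
    assume "degree_over_Q \<alpha> = 2"
    then have "length fs = 2"
      by (simp add: degree_over_Q_def f_def[symmetric] f)
    then obtain p q where "fs = [p, q]"
      by (auto simp: numeral_2_eq_2 length_Suc_conv)
    then show "\<exists>p\<in>\<rat>. \<exists>q\<in>\<rat>. \<alpha>\<^sup>2 + p * \<alpha> + q = 0"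
      using Irr(4) fQ f by (auto simp: power2_eq_square numeral_2_eq_2 add.assoc)
  next
    assume "\<exists>p\<in>\<rat>. \<exists>q\<in>\<rat>. \<alpha>\<^sup>2 + p * \<alpha> + q = 0"
    then obtain p q where pq: "p \<in> \<rat>" "q \<in> \<rat>" "\<alpha>\<^sup>2 + p * \<alpha> + q = 0" by auto
    have car: "[1, p, q] \<in> carrier (\<rat>[X]\<^bsub>complex_ring\<^esub>)"
      using pq by (auto simp: univ_poly_def polynomial_def)
    have "C.eval [1, p, q] \<alpha> = \<zero>\<^bsub>complex_ring\<^esub>"
      using pq by (simp add: power2_eq_square numeral_2_eq_2 add.assoc)
    from C.Irr_minimal[OF subfield_Rats _ alg car this, folded f_def]
    have "Polynomials.degree f \<le> 2"
      using C.pdivides_imp_degree_le[OF subfieldE(1)[OF subfield_Rats] Irr(1) car] by simp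
    then have "length fs \<le> 2" by (simp add: f)
    moreover have "length fs \<noteq> 0"
      using Irr(4) f by auto
    moreover have "length fs \<noteq> 1"
    proof
      assume "length fs = 1"
      then obtain a where "fs = [a]" by (auto simp: length_Suc_conv)
      then have "\<alpha> = - a" "a \<in> \<rat>" using Irr(4) f fQ by (auto simp: eq_neg_iff_add_eq_0)
      then show False using assms(2)
        by (metis Rats_cases' Reals_divide Reals_minus Reals_of_int)
    qed
    ultimately have "length fs = 2" by linarith
    then show "degree_over_Q \<alpha> = 2"
      by (simp add: degree_over_Q_def f_def[symmetric] f)
  qed
qed

end

section \<open>Quadratic algebraic integers\<close>

lemma poly_map_poly_of_int_add:
  "poly (map_poly of_int (p + q)) x =
     poly (map_poly of_int p) x + (poly (map_poly of_int q) x :: 'a :: comm_ring_1)"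
proof -
  have "map_poly of_int (p + q) = map_poly of_int p + (map_poly of_int q :: 'a poly)"
    by (simp add: poly_eq_iff coeff_map_poly)
  then show ?thesis by simp
qed

lemma poly_map_poly_of_int_mult:
  "poly (map_poly of_int (p * q)) x =
     poly (map_poly of_int p) x * (poly (map_poly of_int q) x :: 'a :: comm_ring_1)"
proof (induction p)
  case (pCons a p)
  have "map_poly of_int (smult a q) = smult (of_int a) (map_poly of_int q :: 'a poly)"
    by (simp add: poly_eq_iff coeff_map_poly)
  with pCons show ?case
    by (simp add: map_poly_pCons poly_map_poly_of_int_add algebra_simps)
qed simp

text \<open>The imaginary part of the equation says Im \<alpha> * (p + 2 Re \<alpha>) = 0. As Im
  \<alpha> is nonzero this fixes p, and the real part then fixes q.\<close>

lemma monic_real_quadratic_root_iff: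
  assumes "\<alpha> \<notin> \<real>"
  shows "\<alpha>\<^sup>2 + of_real p * \<alpha> + of_real q = 0 \<longleftrightarrow> p = - 2 * Re \<alpha> \<and> q = (cmod \<alpha>)\<^sup>2"
proof -
  have "Im \<alpha> \<noteq> 0" using assms by (simp add: complex_is_Real_iff)
  have "\<alpha>\<^sup>2 + of_real p * \<alpha> + of_real q = 0 \<longleftrightarrow>
      (Re \<alpha>)\<^sup>2 - (Im \<alpha>)\<^sup>2 + p * Re \<alpha> + q = 0 \<and> Im \<alpha> * (p + 2 * Re \<alpha>) = 0"
    by (simp add: complex_eq_iff algebra_simps power2_eq_square)
  also have "\<dots> \<longleftrightarrow> p = - 2 * Re \<alpha> \<and> (Re \<alpha>)\<^sup>2 - (Im \<alpha>)\<^sup>2 + p * Re \<alpha> + q = 0"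
    using \<open>Im \<alpha> \<noteq> 0\<close> by auto
  also have "\<dots> \<longleftrightarrow> p = - 2 * Re \<alpha> \<and> q = (cmod \<alpha>)\<^sup>2"
    unfolding cmod_power2 by (auto simp: power2_eq_square)
  finally show ?thesis .
qed

text \<open>
  Gauss's lemma by contents: pseudo-division shows that the primitive integer multiple \<open>g\<close> of the
  minimal polynomial divides \<open>c P\<close>, where \<open>P\<close> is a monic integer polynomial vanishing at \<open>\<alpha>\<close>. As \<open>g\<close> has
  content 1 it divides \<open>P\<close> itself, so its leading coefficient is a unit.
\<close>
lemma
  assumes "algebraic_int \<alpha>" "\<alpha> \<notin> \<real>" "2 * Re \<alpha> \<in> \<rat>" "(cmod \<alpha>)\<^sup>2 \<in> \<rat>"
  shows double_Re_Ints_if_algebraic_int: "2 * Re \<alpha> \<in> \<int>"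
    and norm_Ints_if_algebraic_int: "(cmod \<alpha>)\<^sup>2 \<in> \<int>"
proof -
  obtain P where P: "poly (map_poly of_int P) \<alpha> = 0" "lead_coeff P = (1 :: int)"
    using assms(1) by (auto simp: algebraic_int_altdef_ipoly)
  obtain k m where k: "k > (0::int)" "2 * Re \<alpha> = of_int m / of_int k"
    using assms(3) by (elim Rats_cases') auto
  obtain l n where l: "l > (0::int)" "(cmod \<alpha>)\<^sup>2 = of_int n / of_int l"
    using assms(4) by (elim Rats_cases') auto
  \<comment> \<open>The monic real quadratic of \<alpha>, multiplied by \<open>k * l\<close> to
    clear denominators.\<close>
  define f where "f = [:k * n, - (l * m), k * l:]"
  define g where "g = primitive_part f"
  have kl: "k * l \<noteq> 0" using k l by simp
  have root: "\<alpha>\<^sup>2 - of_real (2 * Re \<alpha>) * \<alpha> + of_real ((cmod \<alpha>)\<^sup>2) = 0"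
    using monic_real_quadratic_root_iff[OF assms(2), of "-2 * Re \<alpha>" "(cmod \<alpha>)\<^sup>2"] by simp
  have "poly (map_poly of_int f) \<alpha> = of_int (k * l) * (\<alpha>\<^sup>2 - of_real (2 * Re \<alpha>) * \<alpha> + of_real ((cmod \<alpha>)\<^sup>2))"
    unfolding k l f_def using kl by (simp add: map_poly_pCons field_simps power2_eq_square)
  then have f0: "poly (map_poly of_int f) \<alpha> = 0" unfolding root by simp
  have fg: "f = [:content f:] * g"
    by (simp add: g_def)
  have "f \<noteq> 0" "degree f = 2" using kl by (auto simp: f_def)
  then have cg: "content g = 1" "degree g = 2" "g \<noteq> 0"
    by (auto simp: g_def)
  have g0: "poly (map_poly of_int g) \<alpha> = 0"
    using f0 \<open>f \<noteq> 0\<close> by (subst (asm) fg) (simp only: poly_map_poly_of_int_mult, auto simp: map_poly_pCons)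
  obtain q r where qr: "pseudo_divmod P g = (q, r)" by (meson surj_pair)
  \<comment> \<open>The factor by which pseudo-division scales \<open>P\<close> so that dividing by
    \<open>g\<close> stays within the integers.\<close>
  define c where "c = lead_coeff g ^ (Suc (degree P) - degree g)"
  have "c \<noteq> 0" using cg(3) unfolding c_def by (metis leading_coeff_0_iff power_not_zero)
  have div: "[:c:] * P = g * q + r" and deg: "r = 0 \<or> degree r < 2"
    using pseudo_divmod[OF cg(3) qr] cg by (auto simp: c_def)
  have r0: "poly (map_poly of_int r) \<alpha> = 0"
    using arg_cong[OF div, of "\<lambda>p. poly (map_poly of_int p) \<alpha>"] P(1) g0
    unfolding poly_map_poly_of_int_mult poly_map_poly_of_int_add by simp
  \<comment> \<open>A remainder a + b X vanishing at the non-real \<alpha> has b = 0 by its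
    imaginary part, and then a = 0.\<close>
  have "r = 0"
  proof (rule ccontr)
    assume "r \<noteq> 0"
    with deg obtain a b where r: "r = [:a, b:]"
      by (metis One_nat_def degree1_coeffs degree_eq_zeroE less_2_cases pCons_0_0)
    with r0 have *: "of_int a + of_int b * \<alpha> = 0" by (simp add: map_poly_pCons mult.commute)
    from arg_cong[OF this, of Im] have "b = 0"
      using assms(2) by (simp add: complex_is_Real_iff)
    with * r \<open>r \<noteq> 0\<close> show False by simp
  qed
  with div have "g * q = [:c:] * P" by simp
  then have "content (g * q) = content ([:c:] * P)" by simp
  moreover have "content P = 1"
    using P(2) by (metis content_dvd_coeff is_unit_content_iff)
  \<comment> \<open>Contents are multiplicative, \<open>g\<close> is primitive by construction and
    \<open>P\<close> is primitive because it is monic; so the whole factor \<open>c\<close> sits in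
    \<open>q\<close> and can be cancelled.\<close>
  ultimately have "content q = \<bar>c\<bar>"
    using cg by (simp add: content_mult)
  then have "[:c:] dvd q"
    by (simp add: const_poly_dvd_iff_dvd_content)
  then obtain q' where "q = [:c:] * q'" by (elim dvdE)
  with \<open>g * q = _\<close> have "[:c:] * (g * q') = [:c:] * P" by (simp add: algebra_simps)
  then have "P = g * q'" using \<open>c \<noteq> 0\<close> by (subst (asm) mult_left_cancel) auto
  then have "lead_coeff g * lead_coeff q' = 1" using P(2) by (simp add: lead_coeff_mult)
  then have "lead_coeff g = 1 \<or> lead_coeff g = -1" by (auto simp: zmult_eq_1_iff)
  then obtain s :: int where s: "lead_coeff g = s" "s * s = 1" by auto
  obtain t d where g: "g = [:d, t, s:]"
    using cg(2) s(1) degree2_coeffs[of g]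
    by (metis One_nat_def coeff_pCons_Suc coeff_pCons_0 numeral_2_eq_2)
  \<comment> \<open>As \<open>s\<close> is 1 or -1, multiplying \<open>g\<close> by \<open>s\<close>
    makes it monic, and uniqueness of the monic real quadratic identifies its coefficients.\<close>
  have "of_int s * poly (map_poly of_int g) \<alpha> = of_int (s * s) * \<alpha>\<^sup>2 + of_int (s * t) * \<alpha> + of_int (s * d)"
    unfolding g by (simp add: map_poly_pCons algebra_simps power2_eq_square)
  then have "\<alpha>\<^sup>2 + of_real (of_int (s * t)) * \<alpha> + of_real (of_int (s * d)) = 0"
    unfolding g0 s(2) by simp
  then have "2 * Re \<alpha> = of_int (- s * t)" "(cmod \<alpha>)\<^sup>2 = of_int (s * d)"
    unfolding monic_real_quadratic_root_iff[OF assms(2)] by auto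
  then show "2 * Re \<alpha> \<in> \<int>" "(cmod \<alpha>)\<^sup>2 \<in> \<int>"
    by (metis Ints_of_int)+
qed

lemma of_real_of_rat: "complex_of_real (of_rat r) = of_rat r"
  by (cases r) (simp add: of_rat_rat)

text \<open>Both directions read off the coefficients of the monic quadratic of \<alpha>. Degree and
  integrality are thereby replaced by two conditions on which signs and translations act by plain
  arithmetic.\<close>

lemma quadratic_algebraic_int_iff:
  assumes "\<alpha> \<notin> \<real>"
  shows "quadratic_algebraic_int \<alpha> \<longleftrightarrow> 2 * Re \<alpha> \<in> \<int> \<and> (cmod \<alpha>)\<^sup>2 \<in> \<int>"
proof
  assume "quadratic_algebraic_int \<alpha>"
  then have int: "algebraic_int \<alpha>" and "degree_over_Q \<alpha> = 2"
    by (auto simp: quadratic_algebraic_int_def)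
  then obtain p q where pq: "p \<in> \<rat>" "q \<in> \<rat>" "\<alpha>\<^sup>2 + p * \<alpha> + q = 0"
    using degree_over_Q_eq_2_iff assms by blast
  then obtain p' q' where "p = of_real (of_rat p')" "q = of_real (of_rat q')"
    by (metis Rats_cases of_real_of_rat)
  with pq(3) have "of_rat p' = - 2 * Re \<alpha>" "of_rat q' = (cmod \<alpha>)\<^sup>2"
    using monic_real_quadratic_root_iff[OF assms] by auto
  then have "2 * Re \<alpha> = of_rat (- p')" "(cmod \<alpha>)\<^sup>2 = of_rat q'"
    by (auto simp: of_rat_minus)
  then have "2 * Re \<alpha> \<in> \<rat>" "(cmod \<alpha>)\<^sup>2 \<in> \<rat>"
    by (metis Rats_of_rat)+
  then show "2 * Re \<alpha> \<in> \<int> \<and> (cmod \<alpha>)\<^sup>2 \<in> \<int>"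
    using double_Re_Ints_if_algebraic_int norm_Ints_if_algebraic_int int assms by blast
next
  assume "2 * Re \<alpha> \<in> \<int> \<and> (cmod \<alpha>)\<^sup>2 \<in> \<int>"
  then obtain t d where td: "2 * Re \<alpha> = of_int t" "(cmod \<alpha>)\<^sup>2 = of_int d"
    by (auto elim!: Ints_cases)
  then have root: "\<alpha>\<^sup>2 + of_int (- t) * \<alpha> + of_int d = 0"
    using monic_real_quadratic_root_iff[OF assms, of "of_int (- t)" "of_int d"] by simp
  have "algebraic_int \<alpha>"
    unfolding algebraic_int_altdef_ipoly
    by (rule exI[of _ "[:d, - t, 1:]"])
      (use root in \<open>simp add: map_poly_pCons algebra_simps power2_eq_square\<close>)
  moreover from this root have "degree_over_Q \<alpha> = 2"
    using degree_over_Q_eq_2_iff assms Rats_of_int by blast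
  ultimately show "quadratic_algebraic_int \<alpha>"
    by (simp add: quadratic_algebraic_int_def)
qed

text \<open>Such an x is a root of a monic integer polynomial X^2 - c, and rational algebraic
  integers are integers.\<close>

lemma Ints_if_Rats_if_square_Ints:
  fixes x :: real
  assumes "x \<in> \<rat>" "x\<^sup>2 \<in> \<int>"
  shows "x \<in> \<int>"
proof -
  obtain c where c: "x\<^sup>2 = of_int c" using assms(2) by (elim Ints_cases)
  have "algebraic_int x"
    unfolding algebraic_int_altdef_ipoly
    by (rule exI[of _ "[:- c, 0, 1:]"]) (use c in \<open>simp add: map_poly_pCons power2_eq_square\<close>)
  then show ?thesis
    using assms(1) rational_algebraic_int_is_int by blast
qed

section \<open>The fundamental domain\<close>

text \<open>The bounds are half-open to match the odd case of \<open>I2i\<close>; in the even case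
  the square at the upper end is excluded separately.\<close>

lemma int_between_squares:
  fixes c :: int
  assumes "c > 0"
  obtains m where "m \<ge> 0" "m\<^sup>2 < c" "c \<le> (m + 1)\<^sup>2"
proof
  \<comment> \<open>The ceiling minus one, rather than the floor, puts a square \<open>c\<close> at
    the upper end.\<close>
  define m where "m = \<lceil>sqrt (of_int c)\<rceil> - 1"
  have "sqrt (of_int c) > 0" using assms by simp
  then show m: "m \<ge> 0" by (simp add: m_def)
  have "of_int m < sqrt (of_int c)" "sqrt (of_int c) \<le> of_int (m + 1)"
    unfolding m_def by linarith+
  then have "(of_int m)\<^sup>2 < (of_int c :: real)" "(of_int c :: real) \<le> (of_int (m + 1))\<^sup>2"
    using m real_less_rsqrt[of "of_int m" "of_int c"] sqrt_le_D[of "of_int c" "of_int (m + 1)"] assms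
      power_strict_mono[of "of_int m" "sqrt (of_int c)" 2]
    by auto
  then have "real_of_int (m\<^sup>2) < of_int c" "real_of_int c \<le> of_int ((m + 1)\<^sup>2)"
    by simp_all
  then show "m\<^sup>2 < c" "c \<le> (m + 1)\<^sup>2"
    by (simp_all only: of_int_less_iff of_int_le_iff)
qed

text \<open>With n = 2m + 1 the bounds read m^2 < c <= (m + 1)^2, and these blocks cover the
  positive integers. With n = 2m they read m^2 < c < (m + 1)^2, which leaves out exactly the
  squares.\<close>

lemma mem_S2i_iff_csqrt:
  "\<alpha> \<in> S2i \<longleftrightarrow>
     (\<exists>c::int. c > 0 \<and> (\<alpha> = (1 + csqrt (1 - 4 * of_int c)) / 2 \<or>
        \<alpha> = csqrt (- of_int c) \<and> (\<forall>m. c \<noteq> m\<^sup>2)))"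
proof
  assume "\<alpha> \<in> S2i"
  then obtain n where n: "n \<ge> 1" "\<alpha> \<in> I2i n" by (auto simp: S2i_def)
  show "\<exists>c::int. c > 0 \<and> (\<alpha> = (1 + csqrt (1 - 4 * of_int c)) / 2 \<or>
        \<alpha> = csqrt (- of_int c) \<and> (\<forall>m. c \<noteq> m\<^sup>2))"
  proof (cases "odd n")
    case True
    with n obtain c where c: "\<alpha> = (1 + csqrt (1 - 4 * of_int c)) / 2"
      "((real_of_int n - 1) / 2)\<^sup>2 + 1 \<le> real_of_int c"
      by (auto simp: I2i_def)
    from c(2) have "real_of_int c > 0"
      using zero_le_power2[of "(real_of_int n - 1) / 2"] by linarith
    then have "c > 0" by simp
    with c(1) show ?thesis by blast
  next
    case False
    then obtain m where m: "n = 2 * m" by auto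
    from n False obtain c where c: "\<alpha> = csqrt (- of_int c)"
      and "(real_of_int n / 2)\<^sup>2 < real_of_int c" "real_of_int c < (real_of_int n / 2 + 1)\<^sup>2"
      by (auto simp: I2i_def)
    then have "real_of_int (m\<^sup>2) < real_of_int c" "real_of_int c < real_of_int ((m + 1)\<^sup>2)"
      by (simp_all add: m)
    then have *: "m\<^sup>2 < c" "c < (m + 1)\<^sup>2" "m \<ge> 0"
      using n(1) m by (simp_all only: of_int_less_iff)
    have "c \<noteq> k\<^sup>2" for k
    proof
      assume "c = k\<^sup>2"
      then have "m < \<bar>k\<bar>" "\<bar>k\<bar> < m + 1"
        using * power_less_imp_less_base[of m 2 "\<bar>k\<bar>"] power_less_imp_less_base[of "\<bar>k\<bar>" 2 "m + 1"]
        by auto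
      then show False by simp
    qed
    moreover have "c > 0" using *(1) zero_le_power2[of m] by linarith
    ultimately show ?thesis using c by blast
  qed
next
  assume "\<exists>c::int. c > 0 \<and> (\<alpha> = (1 + csqrt (1 - 4 * of_int c)) / 2 \<or>
        \<alpha> = csqrt (- of_int c) \<and> (\<forall>m. c \<noteq> m\<^sup>2))"
  then obtain c :: int where c: "c > 0" and
    "\<alpha> = (1 + csqrt (1 - 4 * of_int c)) / 2 \<or> \<alpha> = csqrt (- of_int c) \<and> (\<forall>m. c \<noteq> m\<^sup>2)"
    by blast
  from this(2) show "\<alpha> \<in> S2i"
  proof (elim disjE conjE)
    assume \<alpha>: "\<alpha> = (1 + csqrt (1 - 4 * of_int c)) / 2"
    then have "Im \<alpha> = sqrt (4 * of_int c - 1) / 2"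
      using c by (simp only: csqrt_one_minus_four_of_int) simp
    moreover have "4 * real_of_int c - 1 > 0" using c by linarith
    ultimately have "\<alpha> \<notin> \<real>" by (auto simp: complex_is_Real_iff)
    obtain m where m: "m \<ge> 0" "m\<^sup>2 < c" "c \<le> (m + 1)\<^sup>2"
      using int_between_squares[OF c] .
    then have "m\<^sup>2 + 1 \<le> c" by simp
    then have "real_of_int (m\<^sup>2 + 1) \<le> real_of_int c" "real_of_int c \<le> real_of_int ((m + 1)\<^sup>2)"
      using m(3) by (simp_all only: of_int_le_iff)
    then have "((real_of_int (2 * m + 1) - 1) / 2)\<^sup>2 + 1 \<le> real_of_int c"
      "real_of_int c \<le> ((real_of_int (2 * m + 1) + 1) / 2)\<^sup>2"
      by (simp_all add: add_divide_distrib add.commute)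
    moreover have "odd (2 * m + 1)" by simp
    ultimately have "\<alpha> \<in> I2i (2 * m + 1)"
      using \<alpha> \<open>\<alpha> \<notin> \<real>\<close> unfolding I2i_def by (simp only: not_False_eq_True if_True mem_Collect_eq) blast
    moreover have "2 * m + 1 \<in> {1..}" using m by simp
    ultimately show "\<alpha> \<in> S2i" unfolding S2i_def by blast
  next
    assume \<alpha>: "\<alpha> = csqrt (- of_int c)" and sq: "\<forall>m. c \<noteq> m\<^sup>2"
    then have "Im \<alpha> = sqrt (of_int c)"
      using c by (simp only: csqrt_minus_of_int) simp
    with c have "\<alpha> \<notin> \<real>" by (auto simp: complex_is_Real_iff)
    obtain m where m: "m \<ge> 0" "m\<^sup>2 < c" "c \<le> (m + 1)\<^sup>2"
      using int_between_squares[OF c] .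
    with sq have "c < (m + 1)\<^sup>2" by (simp add: order_less_le)
    then have "real_of_int (m\<^sup>2) < real_of_int c" "real_of_int c < real_of_int ((m + 1)\<^sup>2)"
      using m(2) by (simp_all only: of_int_less_iff)
    then have "(real_of_int (2 * m) / 2)\<^sup>2 < real_of_int c"
      "real_of_int c < (real_of_int (2 * m) / 2 + 1)\<^sup>2"
      by simp_all
    moreover have "even (2 * m)" by simp
    ultimately have "\<alpha> \<in> I2i (2 * m)"
      using \<alpha> \<open>\<alpha> \<notin> \<real>\<close> unfolding I2i_def by (simp only: not_True_eq_False if_False mem_Collect_eq) blast
    \<comment> \<open>The index 0 does not occur in \<open>S2i\<close>, but m = 0 would force 0 < c
      < 1.\<close>
    moreover have "m \<noteq> 0" using \<open>c < (m + 1)\<^sup>2\<close> c by auto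
    then have "2 * m \<in> {1..}" using m by simp
    ultimately show "\<alpha> \<in> S2i" unfolding S2i_def by blast
  qed
qed

text \<open>Here \<open>c\<close> is the norm of \<alpha>: the real part contributes 1/4 and the
  imaginary part (4c - 1)/4. Positivity of Im \<alpha> selects the principal root.\<close>

lemma eq_half_plus_csqrt_iff:
  "(\<exists>c::int. c > 0 \<and> \<alpha> = (1 + csqrt (1 - 4 * of_int c)) / 2) \<longleftrightarrow>
     Im \<alpha> > 0 \<and> Re \<alpha> = 1 / 2 \<and> (cmod \<alpha>)\<^sup>2 \<in> \<int>"
proof
  assume "\<exists>c::int. c > 0 \<and> \<alpha> = (1 + csqrt (1 - 4 * of_int c)) / 2"
  then obtain c :: int where c: "c > 0" and "\<alpha> = (1 + csqrt (1 - 4 * of_int c)) / 2" by blast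
  then have \<alpha>: "Re \<alpha> = 1 / 2" "Im \<alpha> = sqrt (4 * of_int c - 1) / 2"
    by (simp_all only: csqrt_one_minus_four_of_int) simp_all
  have pos: "4 * real_of_int c - 1 > 0" using c by linarith
  then have "(cmod \<alpha>)\<^sup>2 = of_int c"
    unfolding cmod_power2 \<alpha> by (simp add: power_divide) (simp add: field_simps power2_eq_square)
  moreover have "Im \<alpha> > 0" unfolding \<alpha> using pos by simp
  ultimately show "Im \<alpha> > 0 \<and> Re \<alpha> = 1 / 2 \<and> (cmod \<alpha>)\<^sup>2 \<in> \<int>"
    using \<alpha>(1) by (metis Ints_of_int)
next
  assume \<alpha>: "Im \<alpha> > 0 \<and> Re \<alpha> = 1 / 2 \<and> (cmod \<alpha>)\<^sup>2 \<in> \<int>"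
  then obtain c where c: "(cmod \<alpha>)\<^sup>2 = of_int c" by (auto elim: Ints_cases)
  then have "4 * of_int c - 1 = (2 * Im \<alpha>)\<^sup>2"
    using \<alpha> unfolding cmod_power2 by (simp add: power_divide)
  then have "sqrt (4 * of_int c - 1) = 2 * Im \<alpha>"
    using \<alpha> by (intro real_sqrt_unique) auto
  moreover have "real_of_int c > 0" unfolding c[symmetric] using \<alpha> by auto
  then have "c > 0" by simp
  ultimately have "\<alpha> = (1 + csqrt (1 - 4 * of_int c)) / 2"
    using \<alpha> by (simp only: csqrt_one_minus_four_of_int) (simp add: complex_eq_iff)
  with \<open>c > 0\<close> show "\<exists>c::int. c > 0 \<and> \<alpha> = (1 + csqrt (1 - 4 * of_int c)) / 2" by blast
qed

lemma eq_csqrt_minus_of_int_iff: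
  fixes c :: int
  assumes "c > 0"
  shows "\<alpha> = csqrt (- of_int c) \<longleftrightarrow> Im \<alpha> > 0 \<and> Re \<alpha> = 0 \<and> (Im \<alpha>)\<^sup>2 = of_int c"
  unfolding csqrt_minus_of_int[OF assms] using assms
  by (auto simp: complex_eq_iff intro: real_sqrt_unique[symmetric])

text \<open>On the imaginary axis the norm is the square of Im \<alpha>, so \<open>c\<close> is a
  non-square exactly when Im \<alpha> is not an integer.\<close>

lemma mem_S2i_iff:
  "\<alpha> \<in> S2i \<longleftrightarrow> Im \<alpha> > 0 \<and> (Re \<alpha> = 0 \<and> Im \<alpha> \<notin> \<int> \<or> Re \<alpha> = 1 / 2) \<and> (cmod \<alpha>)\<^sup>2 \<in> \<int>"
proof -
  have "(\<exists>c::int. c > 0 \<and> \<alpha> = csqrt (- of_int c) \<and> (\<forall>m. c \<noteq> m\<^sup>2)) \<longleftrightarrow>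
      Im \<alpha> > 0 \<and> Re \<alpha> = 0 \<and> Im \<alpha> \<notin> \<int> \<and> (Im \<alpha>)\<^sup>2 \<in> \<int>" (is "?L \<longleftrightarrow> ?R")
  proof
    assume ?L
    then obtain c :: int where c: "c > 0" "\<forall>m. c \<noteq> m\<^sup>2"
      and \<alpha>: "Im \<alpha> > 0" "Re \<alpha> = 0" "(Im \<alpha>)\<^sup>2 = of_int c"
      using eq_csqrt_minus_of_int_iff by blast
    have "Im \<alpha> \<notin> \<int>"
    proof
      assume "Im \<alpha> \<in> \<int>"
      then obtain m where "Im \<alpha> = of_int m" by (elim Ints_cases)
      with \<alpha> have "of_int (m\<^sup>2) = real_of_int c" by simp
      then have "m\<^sup>2 = c" by (simp only: of_int_eq_iff)
      with c show False by auto
    qed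
    with \<alpha> show ?R by simp
  next
    assume R: ?R
    then obtain c where c: "(Im \<alpha>)\<^sup>2 = of_int c" by (auto elim: Ints_cases)
    have "real_of_int c > 0" unfolding c[symmetric] using R by simp
    then have "c > 0" by simp
    moreover have "c \<noteq> m\<^sup>2" for m
    proof
      assume "c = m\<^sup>2"
      with c have "Im \<alpha> = of_int m \<or> Im \<alpha> = - of_int m" by (simp add: power2_eq_iff)
      with R show False by auto
    qed
    ultimately show ?L using R c eq_csqrt_minus_of_int_iff by blast
  qed
  moreover have "Re \<alpha> = 0 \<Longrightarrow> (cmod \<alpha>)\<^sup>2 = (Im \<alpha>)\<^sup>2"
    by (simp add: cmod_power2)
  ultimately show ?thesis
    unfolding mem_S2i_iff_csqrt using eq_half_plus_csqrt_iff[of \<alpha>] by auto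
qed

text \<open>The added positive multiples of \<i> are precisely the points of the imaginary axis that
  \<open>mem_S2i_iff\<close> excludes.\<close>

lemma mem_S2i_hat_iff:
  "\<alpha> \<in> S2i_hat \<longleftrightarrow> Im \<alpha> > 0 \<and> (Re \<alpha> = 0 \<or> Re \<alpha> = 1 / 2) \<and> (cmod \<alpha>)\<^sup>2 \<in> \<int>"
proof -
  have "(\<exists>n::int. n > 0 \<and> \<alpha> = of_int n * \<i>) \<longleftrightarrow> Im \<alpha> > 0 \<and> Re \<alpha> = 0 \<and> Im \<alpha> \<in> \<int>"
    by (auto simp: complex_eq_iff elim!: Ints_cases)
  moreover have "Re \<alpha> = 0 \<Longrightarrow> Im \<alpha> \<in> \<int> \<Longrightarrow> (cmod \<alpha>)\<^sup>2 \<in> \<int>"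
    by (simp add: cmod_power2)
  ultimately show ?thesis
    unfolding S2i_hat_def Un_iff mem_S2i_iff by auto
qed

text \<open>Elements of \<rat>(\<i>) have rational imaginary part. On the axis, integrality of its
  square would make it an integer; on the line Re \<alpha> = 1/2, twice the imaginary part would be
  an integer with square 4c - 1. The claims about \<open>S2i\<close> thus follow from those about
  \<open>S2i_hat\<close>.\<close>

lemma S2i_eq: "S2i = S2i_hat - Q_adjoin \<i>"
proof -
  have "\<alpha> \<notin> Q_adjoin \<i>" if "\<alpha> \<in> S2i" for \<alpha>
  proof
    assume "\<alpha> \<in> Q_adjoin \<i>"
    then have rat: "Im \<alpha> \<in> \<rat>" by (rule Re_Im_Rats_if_mem_Q_adjoin_ii)
    from that consider "Re \<alpha> = 0" "Im \<alpha> \<notin> \<int>" "(cmod \<alpha>)\<^sup>2 \<in> \<int>" | "Re \<alpha> = 1 / 2" "(cmod \<alpha>)\<^sup>2 \<in> \<int>"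
      by (auto simp: mem_S2i_iff)
    then show False
    proof cases
      case 1
      then show ?thesis
        using rat Ints_if_Rats_if_square_Ints[of "Im \<alpha>"] by (simp add: cmod_power2)
    next
      case 2
      then obtain c where "(cmod \<alpha>)\<^sup>2 = of_int c" by (auto elim: Ints_cases)
      moreover have "(1 / 2 :: real)\<^sup>2 = 1 / 4" by (simp add: power_divide)
      ultimately have "(Im \<alpha>)\<^sup>2 = of_int c - 1 / 4"
        unfolding cmod_power2 2(1) by linarith
      then have *: "(2 * Im \<alpha>)\<^sup>2 = of_int (4 * c - 1)"
        unfolding power_mult_distrib by simp
      have "2 * Im \<alpha> \<in> \<int>"
      proof (rule Ints_if_Rats_if_square_Ints)
        show "2 * Im \<alpha> \<in> \<rat>" by (intro Rats_mult rat Rats_number_of)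
        show "(2 * Im \<alpha>)\<^sup>2 \<in> \<int>" unfolding * by (rule Ints_of_int)
      qed
      then obtain m where "2 * Im \<alpha> = of_int m" by (elim Ints_cases)
      with * have "of_int (m\<^sup>2) = real_of_int (4 * c - 1)" by simp
      then have "m\<^sup>2 = 4 * c - 1" by (simp only: of_int_eq_iff)
      \<comment> \<open>Squares are 0 or 1 modulo 4, whereas 4c - 1 is 3.\<close>
      moreover obtain k where "m = 2 * k \<or> m = 2 * k + 1"
        by (metis evenE oddE)
      then have "m\<^sup>2 = 4 * k\<^sup>2 \<or> m\<^sup>2 = 4 * (k\<^sup>2 + k) + 1"
        by (auto simp: power2_eq_square algebra_simps)
      ultimately show ?thesis by presburger
    qed
  qed
  moreover have "\<alpha> \<in> Q_adjoin \<i>" if "\<alpha> \<in> S2i_hat" "\<alpha> \<notin> S2i" for \<alpha>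
  proof -
    from that obtain n :: int where "\<alpha> = of_int n * \<i>" by (auto simp: S2i_hat_def)
    then show ?thesis
      by (auto intro!: subfield_complex_mult subfield_complex_of_int subfield_Q_adjoin Q_adjoin_self)
  qed
  ultimately show ?thesis by (auto simp: S2i_hat_def)
qed

section \<open>Signed integer translates of the fundamental domain\<close>

lemma mem_translate_signed_iff:
  assumes "\<epsilon> \<in> {-1, 1}"
  shows "\<alpha> \<in> translate_set (signed_set \<epsilon> S) n \<longleftrightarrow> of_int \<epsilon> * (\<alpha> - of_int n) \<in> S"
proof
  assume "of_int \<epsilon> * (\<alpha> - of_int n) \<in> S"
  then have "of_int \<epsilon> * (of_int \<epsilon> * (\<alpha> - of_int n)) \<in> signed_set \<epsilon> S"
    using assms by (auto simp: signed_set_def image_iff intro!: bexI[of _ "of_int n - \<alpha>"])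
  then have "of_int \<epsilon> * (of_int \<epsilon> * (\<alpha> - of_int n)) + of_int n \<in> translate_set (signed_set \<epsilon> S) n"
    by (simp add: translate_set_def)
  then show "\<alpha> \<in> translate_set (signed_set \<epsilon> S) n"
    using assms by auto
qed (use assms in \<open>auto simp: translate_set_def signed_set_def\<close>)

text \<open>The sign of Im \<alpha> determines \<epsilon>. With equal signs, 2(n - n') is up to sign
  a difference of two numbers from {0, 1}; being even, it vanishes.\<close>

lemma mem_translate_signed_S2i_hat_unique:
  assumes "of_int \<epsilon> * (\<alpha> - of_int n) \<in> S2i_hat" "of_int \<epsilon>' * (\<alpha> - of_int n') \<in> S2i_hat"
    "\<epsilon> \<in> {-1, 1}" "\<epsilon>' \<in> {-1, 1}"
  shows "\<epsilon> = \<epsilon>'" "n = n'"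
proof -
  show eq: "\<epsilon> = \<epsilon>'"
    using assms by (auto simp: mem_S2i_hat_iff)
  then have "2 * (n - n') \<in> {-1, 0, 1}"
    using assms by (auto simp: mem_S2i_hat_iff)
  then show "n = n'" by auto
qed

lemma quadratic_algebraic_int_iff_translate:
  "quadratic_algebraic_int \<alpha> \<and> \<alpha> \<notin> \<real> \<longleftrightarrow>
     (\<exists>n. \<exists>\<epsilon>\<in>{-1, 1}. of_int \<epsilon> * (\<alpha> - of_int n) \<in> S2i_hat)"
proof
  \<comment> \<open>The sign leaves the norm alone, and the translation changes it by integer
    multiples of 1 and 2 Re \<alpha>, so integrality carries over.\<close>
  have norm: "(cmod (of_int \<epsilon> * (\<alpha> - of_int n)))\<^sup>2 = (cmod \<alpha>)\<^sup>2 - of_int n * (2 * Re \<alpha>) + of_int (n * n)"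
    if "\<epsilon> \<in> {-1, 1}" for \<epsilon> n
    using that unfolding cmod_power2 by (auto simp: power2_eq_square algebra_simps)
  {
    assume *: "quadratic_algebraic_int \<alpha> \<and> \<alpha> \<notin> \<real>"
    then have ints: "2 * Re \<alpha> \<in> \<int>" "(cmod \<alpha>)\<^sup>2 \<in> \<int>"
      using quadratic_algebraic_int_iff by auto
    have Im: "Im \<alpha> \<noteq> 0" using * by (simp add: complex_is_Real_iff)
    define \<epsilon> :: int where "\<epsilon> = (if Im \<alpha> > 0 then 1 else -1)"
    have \<epsilon>: "\<epsilon> \<in> {-1, 1}" by (simp add: \<epsilon>_def)
    obtain t where t: "of_int \<epsilon> * (2 * Re \<alpha>) = of_int t"
      using ints(1) by (metis Ints_cases of_int_mult)
    \<comment> \<open>The translation precedes the sign change, so \<open>n\<close> carries the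
      factor \<epsilon>; what remains as doubled real part is \<open>t mod 2\<close>.\<close>
    define n where "n = \<epsilon> * (t div 2)"
    have "\<epsilon> * n = t div 2" using \<epsilon> by (auto simp: n_def)
    then have "2 * Re (of_int \<epsilon> * (\<alpha> - of_int n)) = of_int t - 2 * of_int (t div 2)"
      using t by (simp add: algebra_simps flip: of_int_mult)
    then have "2 * Re (of_int \<epsilon> * (\<alpha> - of_int n)) = of_int (t mod 2)"
      by (simp flip: minus_mult_div_eq_mod)
    moreover have "t mod 2 = 0 \<or> t mod 2 = 1" by auto
    ultimately have "Re (of_int \<epsilon> * (\<alpha> - of_int n)) = 0 \<or> Re (of_int \<epsilon> * (\<alpha> - of_int n)) = 1 / 2"
      by auto
    moreover have "Im (of_int \<epsilon> * (\<alpha> - of_int n)) > 0"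
      using Im by (auto simp: \<epsilon>_def)
    moreover have "(cmod (of_int \<epsilon> * (\<alpha> - of_int n)))\<^sup>2 \<in> \<int>"
      unfolding norm[OF \<epsilon>] by (intro Ints_add Ints_diff Ints_mult ints) auto
    ultimately show "\<exists>n. \<exists>\<epsilon>\<in>{-1, 1}. of_int \<epsilon> * (\<alpha> - of_int n) \<in> S2i_hat"
      using \<epsilon> mem_S2i_hat_iff by blast
  next
    assume "\<exists>n. \<exists>\<epsilon>\<in>{-1, 1}. of_int \<epsilon> * (\<alpha> - of_int n) \<in> S2i_hat"
    then obtain n \<epsilon> where \<epsilon>: "\<epsilon> \<in> {-1, 1}" and mem: "of_int \<epsilon> * (\<alpha> - of_int n) \<in> S2i_hat"
      by blast
    \<comment> \<open>The doubled real part of the representative is 0 or 1, and undoing the sign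
      may turn 1 into -1.\<close>
    have "2 * Re \<alpha> \<in> {of_int (2 * n), of_int (2 * n + 1), of_int (2 * n - 1)}"
      using mem \<epsilon> by (auto simp: mem_S2i_hat_iff algebra_simps)
    then have Re: "2 * Re \<alpha> \<in> \<int>" by (metis Ints_of_int empty_iff insert_iff)
    have "(cmod \<alpha>)\<^sup>2 = (cmod (of_int \<epsilon> * (\<alpha> - of_int n)))\<^sup>2 + of_int n * (2 * Re \<alpha>) - of_int (n * n)"
      unfolding norm[OF \<epsilon>] by simp
    also have "\<dots> \<in> \<int>"
      using mem by (intro Ints_add Ints_diff Ints_mult Re) (auto simp: mem_S2i_hat_iff)
    moreover have "\<alpha> \<notin> \<real>"
      using mem \<epsilon> by (auto simp: mem_S2i_hat_iff complex_is_Real_iff)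
    ultimately show "quadratic_algebraic_int \<alpha> \<and> \<alpha> \<notin> \<real>"
      using quadratic_algebraic_int_iff Re by auto
  }
qed

section \<open>Generators of imaginary quadratic fields\<close>

lemma translate_signed_mem_subfield_iff:
  assumes "subfield K complex_ring" "\<epsilon> \<in> {-1, 1}"
  shows "of_int \<epsilon> * (\<alpha> - of_int n) \<in> K \<longleftrightarrow> \<alpha> \<in> K"
proof
  assume "\<alpha> \<in> K"
  then show "of_int \<epsilon> * (\<alpha> - of_int n) \<in> K"
    unfolding diff_conv_add_uminus
    by (intro subfield_complex_add subfield_complex_mult subfield_complex_uminus
        subfield_complex_of_int assms(1))
next
  assume "of_int \<epsilon> * (\<alpha> - of_int n) \<in> K"
  then have "of_int \<epsilon> * (of_int \<epsilon> * (\<alpha> - of_int n)) + of_int n \<in> K"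
    by (rule subfield_complex_add[OF assms(1) subfield_complex_mult[OF assms(1)]
          subfield_complex_of_int[OF assms(1)], OF subfield_complex_of_int[OF assms(1)]])
  then show "\<alpha> \<in> K" using assms(2) by auto
qed

lemma imaginary_quadratic_field_primitive_S2i_hat:
  assumes K: "imaginary_quadratic_field K"
  obtains s where "s \<in> S2i_hat" "Q_adjoin s = K"
proof -
  have sub: "subfield K complex_ring" using K by (simp add: imaginary_quadratic_field_def)
  obtain \<alpha> where \<alpha>: "\<alpha> \<in> K" "\<alpha> \<notin> \<real>" using K by (auto simp: imaginary_quadratic_field_def)
  have "\<alpha> * \<alpha> \<in> K" using subfield_complex_mult[OF sub] \<alpha> by blast
  then obtain a b where ab: "a \<in> \<rat>" "b \<in> \<rat>" "\<alpha> * \<alpha> = a + b * \<alpha>"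
    using imaginary_quadratic_field_span[OF K \<alpha>] by metis
  obtain k m where k: "k > (0::int)" "a = of_int m / of_int k"
    using ab(1) by (elim Rats_cases') auto
  obtain l n where l: "l > (0::int)" "b = of_int n / of_int l"
    using ab(2) by (elim Rats_cases') auto
  \<comment> \<open>Scaling by \<open>k * l\<close> turns \<alpha>^2 = m/k + (n/l) \<alpha> into a
    monic quadratic equation with integer coefficients, so \<beta> is integral and still
    non-real.\<close>
  define \<beta> where "\<beta> = of_int (k * l) * \<alpha>"
  have \<beta>: "\<beta> \<notin> \<real>"
    using \<alpha>(2) k l by (simp add: \<beta>_def complex_is_Real_iff)
  have \<beta>K: "\<beta> \<in> K" unfolding \<beta>_def
    by (intro subfield_complex_mult[OF sub] subfield_complex_of_int[OF sub] \<alpha>)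
  have "\<beta>\<^sup>2 = (of_int (k * l))\<^sup>2 * (\<alpha> * \<alpha>)"
    by (simp add: \<beta>_def power2_eq_square)
  also have "\<dots> = of_int (k * n) * \<beta> + of_int (m * k * l * l)"
    unfolding ab(3) k(2) l(2) \<beta>_def using k l by (simp add: field_simps power2_eq_square)
  finally have "\<beta>\<^sup>2 + of_real (of_int (- k * n)) * \<beta> + of_real (of_int (- m * k * l * l)) = 0"
    by simp
  then have "2 * Re \<beta> = of_int (k * n)" "(cmod \<beta>)\<^sup>2 = of_int (- m * k * l * l)"
    unfolding monic_real_quadratic_root_iff[OF \<beta>] by auto
  then have "2 * Re \<beta> \<in> \<int>" "(cmod \<beta>)\<^sup>2 \<in> \<int>"
    by (metis Ints_of_int)+
  then obtain n \<epsilon> where \<epsilon>: "\<epsilon> \<in> {-1, 1}" and mem: "of_int \<epsilon> * (\<beta> - of_int n) \<in> S2i_hat"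
    using quadratic_algebraic_int_iff_translate quadratic_algebraic_int_iff \<beta> by blast
  have "of_int \<epsilon> * (\<beta> - of_int n) \<in> K"
    using translate_signed_mem_subfield_iff[OF sub \<epsilon>] \<beta>K by simp
  moreover have "of_int \<epsilon> * (\<beta> - of_int n) \<notin> \<real>"
    using mem by (auto simp: mem_S2i_hat_iff complex_is_Real_iff)
  ultimately show thesis
    using imaginary_quadratic_field_eq_Q_adjoin[OF K] mem that by blast
qed

text \<open>Write z = x + y * \<i> with x, y rational and y nonzero; then \<i> = (z - x) / y lies in
  every field containing z.\<close>

lemma ii_mem_subfield_if_mem_Q_adjoin_ii:
  assumes "z \<in> Q_adjoin \<i>" "z \<notin> \<real>" "subfield K complex_ring" "z \<in> K"
  shows "\<i> \<in> K"
proof -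
  have Q: "of_real (Re z) \<in> K" "of_real (Im z) \<in> K"
    using Re_Im_Rats_if_mem_Q_adjoin_ii[OF assms(1)] Rats_subset_subfield[OF assms(3)]
    by (metis Rats_cases Rats_of_rat of_real_of_rat subsetD)+
  have "Im z \<noteq> 0" using assms(2) by (simp add: complex_is_Real_iff)
  then have "\<i> = (z + - of_real (Re z)) * inverse (of_real (Im z))"
    by (simp add: complex_eq_iff Re_divide Im_divide field_simps power2_eq_square)
  also have "\<dots> \<in> K"
    by (intro subfield_complex_mult[OF assms(3)] subfield_complex_add[OF assms(3)]
        subfield_complex_uminus[OF assms(3)] subfield_complex_inverse[OF assms(3)] Q assms(4))
  finally show ?thesis .
qed

theorem theorem8:
  shows
    "{\<alpha>. quadratic_algebraic_int \<alpha> \<and> \<alpha> \<notin> \<real>} =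
       (\<Union>(n, \<epsilon>) \<in> UNIV \<times> {-1, 1}. translate_set (signed_set \<epsilon> S2i_hat) n)
     \<and> disjoint_family_on (\<lambda>(n, \<epsilon>). translate_set (signed_set \<epsilon> S2i_hat) n) (UNIV \<times> {-1, 1})
     \<and> {\<alpha>. quadratic_algebraic_int \<alpha> \<and> \<alpha> \<notin> \<real>} - Q_adjoin \<i> =
       (\<Union>(n, \<epsilon>) \<in> UNIV \<times> {-1, 1}. translate_set (signed_set \<epsilon> S2i) n)
     \<and> disjoint_family_on (\<lambda>(n, \<epsilon>). translate_set (signed_set \<epsilon> S2i) n) (UNIV \<times> {-1, 1})
     \<and> (\<forall>K. imaginary_quadratic_field K \<longrightarrow> (\<exists>\<alpha>\<in>S2i_hat. primitive_element K \<alpha>))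
     \<and> (\<forall>K. imaginary_quadratic_field K \<and> K \<noteq> Q_adjoin \<i> \<longrightarrow> (\<exists>\<alpha>\<in>S2i. primitive_element K \<alpha>))"
proof (intro conjI allI impI)
  have mem_Union: "\<alpha> \<in> (\<Union>(n, \<epsilon>) \<in> UNIV \<times> {-1, 1}. translate_set (signed_set \<epsilon> S) n) \<longleftrightarrow>
      (\<exists>n. \<exists>\<epsilon>\<in>{-1, 1}. of_int \<epsilon> * (\<alpha> - of_int n) \<in> S)" for \<alpha> S
    by (auto simp: mem_translate_signed_iff)
  show "{\<alpha>. quadratic_algebraic_int \<alpha> \<and> \<alpha> \<notin> \<real>} =
       (\<Union>(n, \<epsilon>) \<in> UNIV \<times> {-1, 1}. translate_set (signed_set \<epsilon> S2i_hat) n)"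
    unfolding set_eq_iff by (simp only: mem_Union mem_Collect_eq quadratic_algebraic_int_iff_translate) simp
  \<comment> \<open>Signs and integer translations preserve membership in \<rat>(\<i>), so removing
    this field from \<open>S2i_hat\<close> removes it from the whole union.\<close>
  have mem_S2i_iff': "of_int \<epsilon> * (\<alpha> - of_int n) \<in> S2i \<longleftrightarrow>
      of_int \<epsilon> * (\<alpha> - of_int n) \<in> S2i_hat \<and> \<alpha> \<notin> Q_adjoin \<i>" if "\<epsilon> \<in> {-1, 1}" for \<epsilon> \<alpha> n
    by (simp only: S2i_eq Diff_iff translate_signed_mem_subfield_iff[OF subfield_Q_adjoin that])
  show "{\<alpha>. quadratic_algebraic_int \<alpha> \<and> \<alpha> \<notin> \<real>} - Q_adjoin \<i> =
       (\<Union>(n, \<epsilon>) \<in> UNIV \<times> {-1, 1}. translate_set (signed_set \<epsilon> S2i) n)"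
    unfolding set_eq_iff Diff_iff mem_Union mem_Collect_eq quadratic_algebraic_int_iff_translate
    using mem_S2i_iff' by blast
  \<comment> \<open>Stated for any subset of \<open>S2i_hat\<close>, so that it serves both
    unions.\<close>
  have disj: "disjoint_family_on (\<lambda>(n, \<epsilon>). translate_set (signed_set \<epsilon> S) n) (UNIV \<times> {-1, 1})"
    if "S \<subseteq> S2i_hat" for S
    unfolding disjoint_family_on_def
  proof (intro ballI impI)
    fix p p' :: "int \<times> int"
    assume *: "p \<in> UNIV \<times> {-1, 1}" "p' \<in> UNIV \<times> {-1, 1}" "p \<noteq> p'"
    obtain n \<epsilon> where p: "p = (n, \<epsilon>)" by (cases p)
    obtain n' \<epsilon>' where p': "p' = (n', \<epsilon>')" by (cases p')
    from * have \<epsilon>: "\<epsilon> \<in> {-1, 1}" "\<epsilon>' \<in> {-1, 1}" and neq: "n = n' \<longrightarrow> \<epsilon> \<noteq> \<epsilon>'"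
      unfolding p p' by auto
    have "translate_set (signed_set \<epsilon> S) n \<inter> translate_set (signed_set \<epsilon>' S) n' = {}"
    proof (rule ccontr)
      assume "translate_set (signed_set \<epsilon> S) n \<inter> translate_set (signed_set \<epsilon>' S) n' \<noteq> {}"
      then obtain \<alpha> where "\<alpha> \<in> translate_set (signed_set \<epsilon> S) n" "\<alpha> \<in> translate_set (signed_set \<epsilon>' S) n'"
        by blast
      then have "of_int \<epsilon> * (\<alpha> - of_int n) \<in> S2i_hat" "of_int \<epsilon>' * (\<alpha> - of_int n') \<in> S2i_hat"
        using \<epsilon> that mem_translate_signed_iff by blast+
      from mem_translate_signed_S2i_hat_unique[OF this \<epsilon>] neq show False by simp
    qed
    then show "(case p of (n, \<epsilon>) \<Rightarrow> translate_set (signed_set \<epsilon> S) n) \<inter>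
        (case p' of (n, \<epsilon>) \<Rightarrow> translate_set (signed_set \<epsilon> S) n) = {}"
      unfolding p p' prod.case .
  qed
  show "disjoint_family_on (\<lambda>(n, \<epsilon>). translate_set (signed_set \<epsilon> S2i_hat) n) (UNIV \<times> {-1, 1})"
    by (rule disj) simp
  show "disjoint_family_on (\<lambda>(n, \<epsilon>). translate_set (signed_set \<epsilon> S2i) n) (UNIV \<times> {-1, 1})"
    by (rule disj) (auto simp: S2i_eq)
  show "\<exists>\<alpha>\<in>S2i_hat. primitive_element K \<alpha>" if "imaginary_quadratic_field K" for K
    using imaginary_quadratic_field_primitive_S2i_hat[OF that] by (metis primitive_element_def)
  show "\<exists>\<alpha>\<in>S2i. primitive_element K \<alpha>"
    if K: "imaginary_quadratic_field K \<and> K \<noteq> Q_adjoin \<i>" for K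
  proof -
    obtain s where s: "s \<in> S2i_hat" "Q_adjoin s = K"
      using imaginary_quadratic_field_primitive_S2i_hat K by metis
    \<comment> \<open>Otherwise \<open>K\<close> contains \<i>, a non-real element and hence a
      generator, so \<open>K\<close> would be \<rat>(\<i>).\<close>
    have "s \<notin> Q_adjoin \<i>"
    proof
      assume "s \<in> Q_adjoin \<i>"
      moreover have "s \<notin> \<real>" using s by (auto simp: mem_S2i_hat_iff complex_is_Real_iff)
      ultimately have "\<i> \<in> K"
        using ii_mem_subfield_if_mem_Q_adjoin_ii subfield_Q_adjoin Q_adjoin_self s(2) by blast
      then have "Q_adjoin \<i> = K"
        using imaginary_quadratic_field_eq_Q_adjoin K by (auto simp: complex_is_Real_iff)
      with K show False by simp
    qed
    then show ?thesis using s by (auto simp: S2i_eq primitive_element_def)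
  qed
qed

end
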